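(* Let $k$ be a positive integer. The set $\mathcal{W}$ of all weighted $4$-cliques of $(K_{SPC(2k-1)},ad)$ is $(3,2k)$-closed.
   Context: The signed projective cube $SPC(n)$ has vertex set $\mathbb{Z}_2^n$, with a positive edge between vertices at Hamming distance $1$ and a negative edge between vertices at Hamming distance $n$. The sign of a path is the product of its edge signs; the algebraic distance $ad(x,y)$ is $d(x,y)\cdot\sigma(P)$ with $P$ a shortest $x$–$y$ path (a positive one chosen if shortest paths of both signs exist). $(K_{SPC(n)},ad)$ is the complete graph on $\mathbb{Z}_2^n$ in which each edge $uv$ has weight $ad_{SPC(n)}(u,v)$. A signed edge-weighted graph is a graph with nonzero integer edge weights; switching at a vertex negates the weights of incident edges; it is bipartite if a vertex partition $\{X,Y\}$ makes edges between parts odd-weighted and edges inside parts even-weighted. For weights with $1\le|w(e)|\le k$, $\overline{\overline{(H,w)}}_{-2k}$ is the signed graph obtained by replacing each edge $e=xy$ by two internally disjoint $x$–$y$ paths, one of length $|w(e)|$ with the sign of $w(e)$ and one of length $2k-|w(e)|$ with the opposite sign; $(H,w)$ is $2k$-wide if that signed graph has unbalanced girth (length of shortest negative cycle) equal to $2k$. An isomorphism of signed edge-weighted graphs is a switching followed by a weight-preserving bijection mapping edges onto edges. $\mathcal{L}(4,2k)$ is the set of all (unlabeled) bipartite $2k$-wide signed edge-weighted complete graphs on $4$ vertices. A set $\mathcal{W}$ of $4$-cliques (complete subgraphs on 4 vertices with inherited weights) of a signed edge-weighted graph is $(3,2k)$-closed if for every $K\in\mathcal{W}$, every vertex $v$ of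 $K$, every $X\in\mathcal{L}(4,2k)$, every vertex $x$ of $X$ and every isomorphism $\xi$ from $K-v$ to $X-x$, there is $K'\in\mathcal{W}$ containing the vertices of $K-v$ such that $\xi$ extends to an isomorphism of $K'$ and $X$.
   Formalization: In "isomorphism" (a switching followed by a weight-preserving bijection) the weights k and −k count as the same weight, both for the given isomorphism and its extension; with literal equality of weights the claim fails already for k = 2. *)

theory Defs
  imports Main "HOL-Library.Extended_Nat" "HOL-Library.Z2"
begin

section \<open>Signed graphs\<close>

text \<open>
  An edge is its two-element set of ends together with a sign \<open>1\<close> or \<open>-1\<close>. Two parallel edges of
  opposite signs are therefore possible; they occur in the signed projective cube of dimension 1
  and in \<open>double_subst 1 H\<close> below. Parallel edges of the same sign never arise.
\<close>

record 'a sgraph =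
  sverts :: "'a set"
  sedges :: "('a set \<times> int) set"

definition walk_edges :: "'a list \<Rightarrow> int list \<Rightarrow> ('a set \<times> int) list" where
  "walk_edges p s = map (\<lambda>i. ({p ! i, p ! Suc i}, s ! i)) [0..<length s]"

text \<open>A walk is given by its vertices \<open>p\<close> and the signs \<open>s\<close> of its edges; \<open>length s\<close> is its length.\<close>

definition is_walk :: "'a sgraph \<Rightarrow> 'a list \<Rightarrow> int list \<Rightarrow> bool" where
  "is_walk G p s \<longleftrightarrow> length p = Suc (length s) \<and> set p \<subseteq> sverts G \<and>
     set (walk_edges p s) \<subseteq> sedges G"

definition is_path :: "'a sgraph \<Rightarrow> 'a \<Rightarrow> 'a \<Rightarrow> 'a list \<Rightarrow> int list \<Rightarrow> bool" where
  "is_path G x y p s \<longleftrightarrow> is_walk G p s \<and> distinct p \<and> hd p = x \<and> last p = y"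

text \<open>Distinctness of the edges excludes going back and forth along one edge, but admits the
  2-cycle formed by two parallel edges.\<close>

definition is_cycle :: "'a sgraph \<Rightarrow> 'a list \<Rightarrow> int list \<Rightarrow> bool" where
  "is_cycle G p s \<longleftrightarrow> is_walk G p s \<and> 2 \<le> length s \<and> hd p = last p \<and> distinct (tl p) \<and>
     distinct (walk_edges p s)"

definition unbalanced_girth :: "'a sgraph \<Rightarrow> enat" where
  "unbalanced_girth G = Inf {enat (length s) | p s. is_cycle G p s \<and> prod_list s = -1}"

definition sdist :: "'a sgraph \<Rightarrow> 'a \<Rightarrow> 'a \<Rightarrow> nat" where
  "sdist G x y = (LEAST n. \<exists>p s. is_path G x y p s \<and> length s = n)"

definition alg_dist :: "'a sgraph \<Rightarrow> 'a \<Rightarrow> 'a \<Rightarrow> int" where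
  "alg_dist G x y =
     (if \<exists>p s. is_path G x y p s \<and> length s = sdist G x y \<and> prod_list s = 1
      then int (sdist G x y) else - int (sdist G x y))"

definition hamming :: "bit list \<Rightarrow> bit list \<Rightarrow> nat" where
  "hamming x y = card {i. i < length x \<and> x ! i \<noteq> y ! i}"

definition SPC :: "nat \<Rightarrow> bit list sgraph" where
  "SPC n = \<lparr>sverts = {x. length x = n},
     sedges = {({x, y}, 1) | x y. length x = n \<and> length y = n \<and> hamming x y = 1} \<union>
              {({x, y}, -1) | x y. length x = n \<and> length y = n \<and> hamming x y = n}\<rparr>"


section \<open>Signed edge-weighted graphs\<close>

text \<open>Only the values \<open>wt H x y\<close> with \<open>{x, y} \<in> wedges H\<close> are meaningful.\<close>

record 'a wgraph =
  wverts :: "'a set"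
  wedges :: "'a set set"
  wt :: "'a \<Rightarrow> 'a \<Rightarrow> int"

definition pairs :: "'a set \<Rightarrow> 'a set set" where
  "pairs V = {e. e \<subseteq> V \<and> card e = 2}"

definition signed_weighted_graph :: "'a wgraph \<Rightarrow> bool" where
  "signed_weighted_graph H \<longleftrightarrow> finite (wverts H) \<and> wedges H \<subseteq> pairs (wverts H) \<and>
     (\<forall>x y. {x, y} \<in> wedges H \<longrightarrow> wt H x y = wt H y x \<and> wt H x y \<noteq> 0)"

definition complete_graph :: "'a wgraph \<Rightarrow> bool" where
  "complete_graph H \<longleftrightarrow> wedges H = pairs (wverts H)"

definition induced :: "'a set \<Rightarrow> 'a wgraph \<Rightarrow> 'a wgraph" where
  "induced U H = H\<lparr>wverts := U, wedges := {e \<in> wedges H. e \<subseteq> U}\<rparr>"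

definition delete_vertex :: "'a wgraph \<Rightarrow> 'a \<Rightarrow> 'a wgraph" where
  "delete_vertex H v = induced (wverts H - {v}) H"

definition cliques :: "nat \<Rightarrow> 'a wgraph \<Rightarrow> 'a wgraph set" where
  "cliques n H = {induced U H | U. U \<subseteq> wverts H \<and> finite U \<and> card U = n \<and> pairs U \<subseteq> wedges H}"

definition K_SPC :: "nat \<Rightarrow> bit list wgraph" where
  "K_SPC n = \<lparr>wverts = {x. length x = n}, wedges = pairs {x. length x = n},
     wt = alg_dist (SPC n)\<rparr>"

text \<open>The result of switching at every vertex of \<open>S\<close>, one after the other: an edge with both ends
  in \<open>S\<close> is negated twice.\<close>

definition switch :: "'a set \<Rightarrow> 'a wgraph \<Rightarrow> 'a wgraph" where
  "switch S H = H\<lparr>wt := \<lambda>x y. if (x \<in> S) \<noteq> (y \<in> S) then - wt H x y else wt H x y\<rparr>"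

text \<open>
  The weights \<open>k\<close> and \<open>-k\<close> both stand for two paths of length \<open>k\<close> of opposite signs, and the
  algebraic distance is \<open>k\<close> whenever both signs occur at distance \<open>k\<close>, so \<open>k\<close> and \<open>-k\<close> are
  treated as the same weight. Without this identification closedness fails already for \<open>k = 2\<close>:
  for \<open>a = 000\<close>, \<open>b = 011\<close>, \<open>c = 001\<close>, the bipartite 4-wide complete graph on \<open>a, b, c, x\<close> with weights
  \<open>ab = cx = 2\<close>, \<open>ac = bc = 1\<close>, \<open>ax = bx = -1\<close> agrees with \<open>K_SPC 3\<close> on \<open>a, b, c\<close>, but no vertex
  of \<open>K_SPC 3\<close> can take the place of \<open>x\<close>: its weights to \<open>a, b, c\<close> would have to be \<open>-1, -1, 2\<close>
  or \<open>1, 1, -2\<close>.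
\<close>

definition same_weight :: "nat \<Rightarrow> int \<Rightarrow> int \<Rightarrow> bool" where
  "same_weight k a b \<longleftrightarrow> a = b \<or> (\<bar>a\<bar> = int k \<and> \<bar>b\<bar> = int k)"

text \<open>An isomorphism consists of the set \<open>S\<close> switched at and the bijection \<open>f\<close> applied afterwards.\<close>

definition weighted_iso ::
    "nat \<Rightarrow> 'a wgraph \<Rightarrow> 'b wgraph \<Rightarrow> 'a set \<Rightarrow> ('a \<Rightarrow> 'b) \<Rightarrow> bool" where
  "weighted_iso k G H S f \<longleftrightarrow> S \<subseteq> wverts G \<and> bij_betw f (wverts G) (wverts H) \<and>
     (\<lambda>e. f ` e) ` wedges G = wedges H \<and>
     (\<forall>x y. {x, y} \<in> wedges G \<longrightarrow> same_weight k (wt (switch S G) x y) (wt H (f x) (f y)))"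

definition bipartite :: "'a wgraph \<Rightarrow> bool" where
  "bipartite H \<longleftrightarrow> (\<exists>X Y. X \<union> Y = wverts H \<and> X \<inter> Y = {} \<and>
     (\<forall>x y. {x, y} \<in> wedges H \<longrightarrow> (odd (wt H x y) \<longleftrightarrow> (x \<in> X) \<noteq> (y \<in> X))))"

text \<open>
  Replacement of every edge by two paths. For \<open>x < y\<close> the two paths from \<open>x\<close> to \<open>y\<close> are indexed by
  a Boolean \<open>b\<close>; \<open>Inner x y b i\<close> is the internal vertex of path \<open>b\<close> at distance \<open>i\<close> from \<open>x\<close>.
  The first edge of a path carries the sign of the path, all its other edges are positive.
\<close>

datatype 'a gvert = Orig 'a | Inner 'a 'a bool nat

definition path_length :: "nat \<Rightarrow> int \<Rightarrow> bool \<Rightarrow> nat" where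
  "path_length k a b = (if b then nat \<bar>a\<bar> else 2 * k - nat \<bar>a\<bar>)"

definition path_sign :: "int \<Rightarrow> bool \<Rightarrow> int" where
  "path_sign a b = (if b then sgn a else - sgn a)"

definition path_vertex :: "nat \<Rightarrow> 'a \<Rightarrow> 'a \<Rightarrow> int \<Rightarrow> bool \<Rightarrow> nat \<Rightarrow> 'a gvert" where
  "path_vertex k x y a b i =
     (if i = 0 then Orig x else if i = path_length k a b then Orig y else Inner x y b i)"

definition double_subst :: "nat \<Rightarrow> 'a::linorder wgraph \<Rightarrow> 'a gvert sgraph" where
  "double_subst k H = \<lparr>
     sverts = Orig ` wverts H \<union>
       {path_vertex k x y (wt H x y) b i | x y b i.
          x < y \<and> {x, y} \<in> wedges H \<and> i \<le> path_length k (wt H x y) b},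
     sedges =
       {({path_vertex k x y (wt H x y) b i, path_vertex k x y (wt H x y) b (Suc i)},
         if i = 0 then path_sign (wt H x y) b else 1) | x y b i.
          x < y \<and> {x, y} \<in> wedges H \<and> i < path_length k (wt H x y) b}\<rparr>"

definition wide :: "nat \<Rightarrow> 'a::linorder wgraph \<Rightarrow> bool" where
  "wide k H \<longleftrightarrow> (\<forall>x y. {x, y} \<in> wedges H \<longrightarrow> 1 \<le> \<bar>wt H x y\<bar> \<and> \<bar>wt H x y\<bar> \<le> int k) \<and>
     unbalanced_girth (double_subst k H) = enat (2 * k)"

text \<open>\<open>wide_complete n k\<close> is the class of graphs usually written \<open>\<L>(n, 2k)\<close>. Its members are
  unlabelled; every finite graph has isomorphic copies with vertices in \<open>nat\<close>, and all of these
  are included.\<close>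

definition wide_complete :: "nat \<Rightarrow> nat \<Rightarrow> nat wgraph set" where
  "wide_complete n k = {X. signed_weighted_graph X \<and> complete_graph X \<and> card (wverts X) = n \<and>
     bipartite X \<and> wide k X}"

text \<open>\<open>closed3 G k W\<close>: the set \<open>W\<close> of 4-cliques of \<open>G\<close> is \<open>(3, 2k)\<close>-closed.\<close>

definition closed3 :: "'a wgraph \<Rightarrow> nat \<Rightarrow> 'a wgraph set \<Rightarrow> bool" where
  "closed3 G k W \<longleftrightarrow> W \<subseteq> cliques 4 G \<and>
     (\<forall>K \<in> W. \<forall>v \<in> wverts K. \<forall>X \<in> wide_complete 4 k. \<forall>x \<in> wverts X. \<forall>S \<xi>.
        weighted_iso k (delete_vertex K v) (delete_vertex X x) S \<xi> \<longrightarrow>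
        (\<exists>K' \<in> W. wverts K - {v} \<subseteq> wverts K' \<and>
           (\<exists>S' \<xi>'. weighted_iso k K' X S' \<xi>' \<and>
              S' \<inter> (wverts K - {v}) = S \<and> (\<forall>u \<in> wverts K - {v}. \<xi>' u = \<xi> u))))"

end

theory Submission
  imports Defs
begin

text \<open>
  Replace a weight by the length of the positive one of the two paths substituted for its edge.
  In the double cover of the signed projective cube by the cube of dimension \<open>2 * k\<close> this length is
  the Hamming distance of the lifts, and switching at a vertex changes its lift to the complement.
  A bipartite \<open>2k\<close>-wide complete graph becomes a metric in which every triangle has an even perimeter
  of at most \<open>4 * k\<close>: the inequalities come from the negative cycles through three vertices.
  In the cube of dimension \<open>2 * k\<close>, three points always extend by a fourth one with distances that
  satisfy these conditions.
\<close>

section \<open>Extending three points of a cube by a fourth\<close>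

text \<open>These conditions characterise the pairwise Hamming distances of three points in the cube
  of dimension \<open>m\<close>: each coordinate contributes 0 or 2 to the perimeter.\<close>

definition even_triangle :: "nat \<Rightarrow> nat \<Rightarrow> nat \<Rightarrow> nat \<Rightarrow> bool" where
  "even_triangle m a b c \<longleftrightarrow>
     even (a + b + c) \<and> a \<le> b + c \<and> b \<le> a + c \<and> c \<le> a + b \<and> a + b + c \<le> 2 * m"

lemma even_triangle_perms:
  "even_triangle m a b c \<Longrightarrow> even_triangle m a c b"
  "even_triangle m a b c \<Longrightarrow> even_triangle m b a c"
  "even_triangle m a b c \<Longrightarrow> even_triangle m b c a"
  "even_triangle m a b c \<Longrightarrow> even_triangle m c a b"
  "even_triangle m a b c \<Longrightarrow> even_triangle m c b a"
  unfolding even_triangle_def by presburger+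

text \<open>Here \<open>a\<close>, \<open>b\<close>, \<open>c\<close> count the coordinates where
  one of three points disagrees with the other two, \<open>z\<close> those where all agree, and
  \<open>p\<close>, \<open>q\<close>, \<open>r\<close>, \<open>s\<close> the coordinates of each
  kind where the fourth point leaves the median. Adding the equations in pairs determines
  \<open>p + s\<close>, \<open>q + s\<close> and \<open>r + s\<close>, so only \<open>s\<close>
  remains to be chosen.\<close>

lemma even_triangle_fourth_sizes:
  fixes a b c z x1 x2 x3 :: nat
  defines "m \<equiv> a + b + c + z"
  assumes "even_triangle m x1 x2 (a + b)" "even_triangle m x1 x3 (a + c)"
    "even_triangle m x2 x3 (b + c)"
  obtains p q r s where "p \<le> a" "q \<le> b" "r \<le> c" "s \<le> z"
    "x1 = (a - p) + q + r + s" "x2 = p + (b - q) + r + s" "x3 = p + q + (c - r) + s"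
proof -
  have ev: "even (x1 + x2 + (a + b))" "even (x1 + x3 + (a + c))" "even (x2 + x3 + (b + c))"
    and le: "b + c \<le> x2 + x3" "a + c \<le> x1 + x3" "a + b \<le> x1 + x2"
    using assms by (simp_all add: even_triangle_def)
  define P where "P = (x2 + x3 - (b + c)) div 2"
  have P: "x2 + x3 = b + c + 2 * P"
    using ev(3) le(1) unfolding P_def by presburger
  define Q where "Q = (x1 + x3 - (a + c)) div 2"
  have Q: "x1 + x3 = a + c + 2 * Q"
    using ev(2) le(2) unfolding Q_def by presburger
  define R where "R = (x1 + x2 - (a + b)) div 2"
  have R: "x1 + x2 = a + b + 2 * R"
    using ev(1) le(3) unfolding R_def by presburger
  \<comment> \<open>The least admissible value. The perimeter bounds give \<open>s \<le> z\<close>;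
    the triangle inequalities give that \<open>s\<close> exceeds none of \<open>P\<close>,
    \<open>Q\<close>, \<open>R\<close>.\<close>
  define s where "s = max (max (P - a) (Q - b)) (R - c)"
  have bounds: "P \<le> s + a" "Q \<le> s + b" "R \<le> s + c" "s \<le> z" "s \<le> P" "s \<le> Q" "s \<le> R"
    using assms P Q R by (auto simp: s_def even_triangle_def)
  show thesis
    by (rule that[of "P - s" "Q - s" "R - s" s]) (use bounds P Q R in auto)
qed

text \<open>The three given sets split the ground set into the places where one of them disagrees with
  the other two and the places where all agree. The fourth set differs from their median in a
  prescribed number of places of each kind.\<close>

lemma ex_fourth_set:
  assumes N: "finite N"
    and "even_triangle (card N) x1 x2 (card {i \<in> N. (i \<in> A) \<noteq> (i \<in> B)})"
    and "even_triangle (card N) x1 x3 (card {i \<in> N. (i \<in> A) \<noteq> (i \<in> C)})"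
    and "even_triangle (card N) x2 x3 (card {i \<in> N. (i \<in> B) \<noteq> (i \<in> C)})"
  obtains Y where "Y \<subseteq> N"
    "card {i \<in> N. (i \<in> Y) \<noteq> (i \<in> A)} = x1"
    "card {i \<in> N. (i \<in> Y) \<noteq> (i \<in> B)} = x2"
    "card {i \<in> N. (i \<in> Y) \<noteq> (i \<in> C)} = x3"
proof -
  define EA where "EA = {i \<in> N. (i \<in> B) = (i \<in> C) \<and> (i \<in> A) \<noteq> (i \<in> B)}"
  define EB where "EB = {i \<in> N. (i \<in> A) = (i \<in> C) \<and> (i \<in> B) \<noteq> (i \<in> A)}"
  define EC where "EC = {i \<in> N. (i \<in> A) = (i \<in> B) \<and> (i \<in> C) \<noteq> (i \<in> A)}"
  define E0 where "E0 = {i \<in> N. (i \<in> A) = (i \<in> B) \<and> (i \<in> A) = (i \<in> C)}"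
  note E_defs = EA_def EB_def EC_def E0_def
  have fin: "finite EA" "finite EB" "finite EC" "finite E0" using N by (auto simp: E_defs)
  have disj: "EA \<inter> EB = {}" "EA \<inter> EC = {}" "EB \<inter> EC = {}" "(EA \<union> EB \<union> EC) \<inter> E0 = {}"
    "(EA \<union> EB) \<inter> EC = {}"
    by (auto simp: E_defs)
  have "N = EA \<union> EB \<union> EC \<union> E0" by (auto simp: E_defs)
  then have cN: "card N = card EA + card EB + card EC + card E0"
    using fin disj by (simp add: card_Un_disjoint)
  have "{i \<in> N. (i \<in> A) \<noteq> (i \<in> B)} = EA \<union> EB" "{i \<in> N. (i \<in> A) \<noteq> (i \<in> C)} = EA \<union> EC"
    "{i \<in> N. (i \<in> B) \<noteq> (i \<in> C)} = EB \<union> EC"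
    by (auto simp: E_defs)
  then have "card {i \<in> N. (i \<in> A) \<noteq> (i \<in> B)} = card EA + card EB"
    "card {i \<in> N. (i \<in> A) \<noteq> (i \<in> C)} = card EA + card EC"
    "card {i \<in> N. (i \<in> B) \<noteq> (i \<in> C)} = card EB + card EC"
    using fin disj by (simp_all add: card_Un_disjoint)
  note triangles = assms(2-4)[unfolded cN this]
  obtain p q r s where
    le: "p \<le> card EA" "q \<le> card EB" "r \<le> card EC" "s \<le> card E0"
    and x: "x1 = (card EA - p) + q + r + s" "x2 = p + (card EB - q) + r + s"
      "x3 = p + q + (card EC - r) + s"
    by (rule even_triangle_fourth_sizes[OF triangles])
  obtain P Q R Z where sub: "P \<subseteq> EA" "Q \<subseteq> EB" "R \<subseteq> EC" "Z \<subseteq> E0"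
    and card: "card P = p" "card Q = q" "card R = r" "card Z = s"
    using le by (meson obtain_subset_with_card_n)
  have finP: "finite P" "finite Q" "finite R" "finite Z"
    using sub fin by (meson finite_subset)+
  \<comment> \<open>Stated for arbitrary subsets because each of the three counts below replaces one
    piece by its complement in its class.\<close>
  have card_Un: "card (P' \<union> Q' \<union> R' \<union> Z') = card P' + card Q' + card R' + card Z'"
    if "P' \<subseteq> EA" "Q' \<subseteq> EB" "R' \<subseteq> EC" "Z' \<subseteq> E0" for P' Q' R' Z'
  proof -
    have "finite P'" "finite Q'" "finite R'" "finite Z'"
      using that fin by (meson finite_subset)+
    moreover have "P' \<inter> Q' = {}" "(P' \<union> Q') \<inter> R' = {}" "(P' \<union> Q' \<union> R') \<inter> Z' = {}"
      using that disj by blast+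
    ultimately show ?thesis by (simp add: card_Un_disjoint)
  qed
  define M where "M = {i. (i \<in> A \<and> i \<in> B) \<or> (i \<in> A \<and> i \<in> C) \<or> (i \<in> B \<and> i \<in> C)}"
  define Y where "Y = {i \<in> N. (i \<in> M) \<noteq> (i \<in> P \<union> Q \<union> R \<union> Z)}"
  have memP: "i \<in> P \<Longrightarrow> i \<in> EA" "i \<in> Q \<Longrightarrow> i \<in> EB" "i \<in> R \<Longrightarrow> i \<in> EC" "i \<in> Z \<Longrightarrow> i \<in> E0" for i
    using sub by auto
  have Y: "i \<in> Y \<longleftrightarrow> i \<in> N \<and> ((i \<in> M) \<noteq> (i \<in> P \<or> i \<in> Q \<or> i \<in> R \<or> i \<in> Z))" for i
    by (simp add: Y_def)
  show thesis
  proof (rule that[of Y])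
    show "Y \<subseteq> N" by (auto simp: Y_def)
    \<comment> \<open>Within \<open>N\<close> the median differs from \<open>A\<close> exactly on
      \<open>EA\<close>. A change inside \<open>EA\<close> removes a difference, a change anywhere
      else creates one. The same holds for \<open>B\<close> and \<open>C\<close> below.\<close>
    have "{i \<in> N. (i \<in> Y) \<noteq> (i \<in> A)} = (EA - P) \<union> Q \<union> R \<union> Z"
      (is "?L = ?R")
    proof (rule set_eqI)
      fix i
      show "i \<in> ?L \<longleftrightarrow> i \<in> ?R"
        using memP[of i] unfolding Y M_def E_defs Un_iff Diff_iff mem_Collect_eq by argo
    qed
    then show "card {i \<in> N. (i \<in> Y) \<noteq> (i \<in> A)} = x1"
      using sub x card finP by (simp add: card_Un card_Diff_subset)
    have "{i \<in> N. (i \<in> Y) \<noteq> (i \<in> B)} = P \<union> (EB - Q) \<union> R \<union> Z"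
      (is "?L = ?R")
    proof (rule set_eqI)
      fix i
      show "i \<in> ?L \<longleftrightarrow> i \<in> ?R"
        using memP[of i] unfolding Y M_def E_defs Un_iff Diff_iff mem_Collect_eq by argo
    qed
    then show "card {i \<in> N. (i \<in> Y) \<noteq> (i \<in> B)} = x2"
      using sub x card finP by (simp add: card_Un card_Diff_subset)
    have "{i \<in> N. (i \<in> Y) \<noteq> (i \<in> C)} = P \<union> Q \<union> (EC - R) \<union> Z"
      (is "?L = ?R")
    proof (rule set_eqI)
      fix i
      show "i \<in> ?L \<longleftrightarrow> i \<in> ?R"
        using memP[of i] unfolding Y M_def E_defs Un_iff Diff_iff mem_Collect_eq by argo
    qed
    then show "card {i \<in> N. (i \<in> Y) \<noteq> (i \<in> C)} = x3"
      using sub x card finP by (simp add: card_Un card_Diff_subset)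
  qed
qed

section \<open>Algebraic distance in the signed projective cube\<close>

lemma is_walk_iff:
  "is_walk G p s \<longleftrightarrow> length p = Suc (length s) \<and> set p \<subseteq> sverts G \<and>
     (\<forall>i < length s. ({p ! i, p ! Suc i}, s ! i) \<in> sedges G)"
  by (auto simp: is_walk_def walk_edges_def)

lemma is_walk_single [simp]: "is_walk G [x] s \<longleftrightarrow> x \<in> sverts G \<and> s = []"
  by (auto simp: is_walk_iff)

lemma is_walk_Cons [simp]:
  "is_walk G (x # y # p) (e # s) \<longleftrightarrow>
     x \<in> sverts G \<and> ({x, y}, e) \<in> sedges G \<and> is_walk G (y # p) s"
  by (auto simp: is_walk_iff All_less_Suc2)

text \<open>The junction \<open>last p\<close> is listed once: \<open>q\<close> holds only the
  vertices after it.\<close>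

lemma is_walk_append:
  assumes "length p = Suc (length s)"
  shows "is_walk G (p @ q) (s @ t) \<longleftrightarrow> is_walk G p s \<and> is_walk G (last p # q) t"
  using assms
proof (induction s arbitrary: p)
  case Nil
  then obtain x where p: "p = [x]" by (auto simp: length_Suc_conv)
  show ?case unfolding p by (auto simp: is_walk_iff)
next
  case (Cons e s)
  then obtain x y p' where p: "p = x # y # p'" by (auto simp: length_Suc_conv)
  show ?case using Cons.IH[of "y # p'"] Cons.prems unfolding p by simp
qed

lemma is_walk_snoc:
  "is_walk G (p @ [y]) (s @ [e]) \<longleftrightarrow>
     is_walk G p s \<and> y \<in> sverts G \<and> ({last p, y}, e) \<in> sedges G"
proof (cases "length p = Suc (length s)")
  case True
  then have "p \<noteq> []" by auto
  then have "is_walk G p s \<Longrightarrow> last p \<in> sverts G" by (auto simp: is_walk_iff)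
  with True show ?thesis by (auto simp: is_walk_append)
qed (auto simp: is_walk_iff)

section \<open>Hamming distance, antipodes and flips of one coordinate\<close>

lemma bit_neq_trans: "a \<noteq> c \<longleftrightarrow> (a \<noteq> b) \<noteq> (b \<noteq> c)" for a b c :: bit
  by (cases a; cases b; cases c) auto

lemma hamming_commute: "length x = length y \<Longrightarrow> hamming x y = hamming y x"
  by (auto simp: hamming_def eq_commute)

lemma hamming_le: "hamming x y \<le> length x"
  unfolding hamming_def using card_mono[of "{..<length x}" "{i. i < length x \<and> x ! i \<noteq> y ! i}"]
  by auto

lemma hamming_triangle:
  assumes "length x = n" "length y = n" "length z = n"
  shows "hamming x z \<le> hamming x y + hamming y z"
proof -
  have "card {i. i < n \<and> x ! i \<noteq> z ! i} \<le>
      card ({i. i < n \<and> x ! i \<noteq> y ! i} \<union> {i. i < n \<and> y ! i \<noteq> z ! i})"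
    by (rule card_mono) auto
  also have "\<dots> \<le> card {i. i < n \<and> x ! i \<noteq> y ! i} + card {i. i < n \<and> y ! i \<noteq> z ! i}"
    by (rule card_Un_le)
  finally show ?thesis using assms by (simp add: hamming_def)
qed

lemma hamming_eq_length_iff:
  assumes "length x = n"
  shows "hamming x y = n \<longleftrightarrow> (\<forall>i < n. x ! i \<noteq> y ! i)"
proof
  assume "hamming x y = n"
  then have "{i. i < n \<and> x ! i \<noteq> y ! i} = {..<n}"
    using assms by (intro card_subset_eq) (auto simp: hamming_def)
  then show "\<forall>i < n. x ! i \<noteq> y ! i" by blast
next
  assume *: "\<forall>i < n. x ! i \<noteq> y ! i"
  have "{i. i < n \<and> x ! i \<noteq> y ! i} = {..<n}" using * by auto
  then show "hamming x y = n" using assms by (simp add: hamming_def)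
qed

lemma hamming_eq_0_iff:
  assumes "length x = n" "length y = n"
  shows "hamming x y = 0 \<longleftrightarrow> x = y"
  using assms by (auto simp: hamming_def list_eq_iff_nth_eq)

text \<open>\<open>z\<close> is the complement of \<open>y\<close>, so each coordinate of
  \<open>x\<close> disagrees with exactly one of the two.\<close>

lemma hamming_antipode:
  assumes len: "length x = n" "length y = n" "length z = n" and yz: "hamming y z = n"
  shows "hamming x y + hamming x z = n"
proof -
  have "y ! i \<noteq> z ! i" if "i < n" for i
    using yz that hamming_eq_length_iff[OF len(2)] by blast
  then have *: "{i. i < n \<and> x ! i \<noteq> z ! i} = {..<n} - {i. i < n \<and> x ! i \<noteq> y ! i}"
    using bit_neq_trans by blast
  have "card {i. i < n \<and> x ! i \<noteq> z ! i} = n - card {i. i < n \<and> x ! i \<noteq> y ! i}"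
    by (subst *, subst card_Diff_subset) auto
  then show ?thesis using len hamming_le[of x y] by (simp add: hamming_def)
qed

lemma hamming_flip:
  assumes "length y = n" "i < n"
  shows "hamming (y[i := y ! i + 1]) y = 1"
proof -
  have "{j. j < n \<and> y[i := y ! i + 1] ! j \<noteq> y ! j} = {i}"
    using assms by (auto simp: nth_list_update)
  then show ?thesis using assms by (simp add: hamming_def)
qed

lemma hamming_flip_differing:
  assumes "length x = n" "length y = n" "i < n" "x ! i \<noteq> y ! i"
  shows "Suc (hamming x (y[i := y ! i + 1])) = hamming x y"
proof -
  have "x ! i = y ! i + 1" using assms(4) by (cases "x ! i"; cases "y ! i") auto
  then have "{j. j < n \<and> x ! j \<noteq> y[i := y ! i + 1] ! j} = {j. j < n \<and> x ! j \<noteq> y ! j} - {i}"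
    using assms by (auto simp: nth_list_update)
  moreover have "Suc (card ({j. j < n \<and> x ! j \<noteq> y ! j} - {i})) = card {j. j < n \<and> x ! j \<noteq> y ! j}"
    using assms by (intro card_Suc_Diff1) auto
  ultimately show ?thesis using assms by (simp only: hamming_def length_list_update)
qed

lemma hamming_flip_agreeing:
  assumes "length x = n" "length y = n" "i < n" "x ! i = y ! i"
  shows "hamming x (y[i := y ! i + 1]) = Suc (hamming x y)"
proof -
  have "{j. j < n \<and> x ! j \<noteq> y[i := y ! i + 1] ! j} = insert i {j. j < n \<and> x ! j \<noteq> y ! j}"
    using assms by (auto simp: nth_list_update)
  then show ?thesis using assms by (simp add: hamming_def)
qed

section \<open>Shortest walks of either sign\<close>

lemma sverts_SPC [simp]: "sverts (SPC n) = {x. length x = n}"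
  by (simp add: SPC_def)

lemma sedges_SPC_iff:
  "({x, y}, e) \<in> sedges (SPC n) \<longleftrightarrow> length x = n \<and> length y = n \<and>
     (e = 1 \<and> hamming x y = 1 \<or> e = -1 \<and> hamming x y = n)"
  by (auto simp: SPC_def doubleton_eq_iff hamming_commute)

text \<open>The length of a shortest walk from \<open>x\<close> to \<open>y\<close> that is positive (\<open>b\<close>) or negative (\<open>\<not> b\<close>), in the
  signed projective cube of dimension \<open>length x\<close>.\<close>

definition signed_hamming :: "bool \<Rightarrow> bit list \<Rightarrow> bit list \<Rightarrow> nat" where
  "signed_hamming b x y = (if b then hamming x y else Suc (length x) - hamming x y)"

text \<open>Induction on the last edge. A positive edge changes the Hamming distance to
  \<open>x\<close> by at most one. A negative edge reverses the sign and replaces the distance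
  \<open>h\<close> by \<open>n - h\<close>, which again changes the signed length by one.\<close>

lemma SPC_walk_length:
  assumes "is_walk (SPC n) p s" "hd p = x"
  shows "(prod_list s = 1 \<or> prod_list s = -1) \<and>
    signed_hamming (prod_list s = 1) x (last p) \<le> length s"
  using assms
proof (induction s arbitrary: p rule: rev_induct)
  case Nil
  then obtain v where "p = [v]" by (auto simp: is_walk_iff length_Suc_conv)
  then show ?case using Nil by (simp add: signed_hamming_def hamming_def)
next
  case (snoc e s)
  from snoc.prems have "p \<noteq> []" by (auto simp: is_walk_iff)
  then obtain q y where p: "p = q @ [y]" by (meson rev_exhaust)
  with snoc.prems(1) have q: "is_walk (SPC n) q s" and e: "({last q, y}, e) \<in> sedges (SPC n)"
    by (simp_all add: is_walk_snoc)
  have "q \<noteq> []" using q by (auto simp: is_walk_iff)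
  then have hd: "hd q = x" using snoc.prems(2) p by simp
  moreover have "hd q \<in> sverts (SPC n)"
    using q \<open>q \<noteq> []\<close> by (auto simp: is_walk_iff dest: hd_in_set)
  ultimately have lenx: "length x = n" by simp
  note IH = snoc.IH[OF q hd]
  note tri = hamming_triangle[of x n "last q" y] hamming_triangle[of x n y "last q"]
    hamming_antipode[of x n "last q" y] hamming_commute[of y "last q"]
    hamming_le[of x y] hamming_le[of x "last q"]
  show ?case
    using IH e lenx tri p by (auto simp: sedges_SPC_iff signed_hamming_def split: if_splits)
qed

text \<open>The bound on the vertices makes a path stay distinct when it is extended: the new end lies
  beyond the bound.\<close>

lemma SPC_path_exists:
  assumes "n = 2 * k - 1" "0 < k" "length x = n" "length y = n"
    "signed_hamming b x y = m" "m \<le> k"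
  shows "\<exists>p s. is_path (SPC n) x y p s \<and> length s = m \<and> prod_list s = (if b then 1 else -1) \<and>
    (\<forall>v \<in> set p. min (hamming x v) (2 * k - hamming x v) \<le> m)"
  using assms(4-)
proof (induction m arbitrary: y b)
  case 0
  then have b: "b" "hamming x y = 0"
    using hamming_le[of x y] by (auto simp: signed_hamming_def split: if_splits)
  then have "x = y" using 0 assms hamming_eq_0_iff by blast
  then have "is_path (SPC n) x y [x] []"
    using 0 by (simp add: is_path_def is_walk_iff)
  then show ?case using b \<open>x = y\<close> by fastforce
next
  case (Suc m)
  have hle: "hamming x y \<le> n" using hamming_le[of x y] assms by simp
  \<comment> \<open>The vertex before \<open>y\<close> has to have signed length exactly
    \<open>m\<close>. A positive walk arrives by correcting a coordinate in which \<open>x\<close>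
    and \<open>y\<close> differ.\<close>
  have "\<exists>z c e. length z = n \<and> signed_hamming c x z = m \<and> ({z, y}, e) \<in> sedges (SPC n) \<and>
      (if c then 1 else -1) * e = (if b then 1 else -1)"
  proof (cases b)
    case True
    then have "hamming x y \<noteq> 0" using Suc by (simp add: signed_hamming_def)
    then obtain i where i: "i < n" "x ! i \<noteq> y ! i"
      using assms by (auto simp: hamming_def card_gt_0_iff)
    show ?thesis
      by (rule exI[of _ "y[i := y ! i + 1]"], rule exI[of _ True], rule exI[of _ 1])
        (use True Suc i assms hamming_flip_differing[of x n y i] hamming_flip[of y n i] in
          \<open>auto simp: signed_hamming_def sedges_SPC_iff\<close>)
  next
    case False
    show ?thesis
    proof (cases "hamming x y = n")
      case True
      \<comment> \<open>Here \<open>y\<close> is the antipode of \<open>x\<close>, so the walk is a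
        single negative edge.\<close>
      show ?thesis
        by (rule exI[of _ x], rule exI[of _ True], rule exI[of _ "-1"])
          (use True False Suc assms in
            \<open>auto simp: signed_hamming_def sedges_SPC_iff hamming_def\<close>)
    next
      case ne: False
      then obtain i where i: "i < n" "x ! i = y ! i"
        using hamming_eq_length_iff assms by blast
      \<comment> \<open>Flipping a coordinate of agreement moves towards the antipode of
        \<open>x\<close>, which shortens negative walks.\<close>
      show ?thesis
        by (rule exI[of _ "y[i := y ! i + 1]"], rule exI[of _ False], rule exI[of _ 1])
          (use False Suc i assms hamming_flip_agreeing[of x n y i] hamming_flip[of y n i] in
            \<open>auto simp: signed_hamming_def sedges_SPC_iff\<close>)
    qed
  qed
  then obtain z c e where z: "length z = n" "signed_hamming c x z = m"
    and e: "({z, y}, e) \<in> sedges (SPC n)" "(if c then 1 else -1) * e = (if b then 1 else -1)"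
    by blast
  obtain p s where p: "is_path (SPC n) x z p s" "length s = m"
    "prod_list s = (if c then 1 else -1)"
    "\<forall>v \<in> set p. min (hamming x v) (2 * k - hamming x v) \<le> m"
    using Suc.IH[OF z] Suc.prems(3) by auto
  \<comment> \<open>The two signed lengths of \<open>y\<close> add up to \<open>2 * k\<close>, so
    the one that is at most \<open>k\<close> is the minimum.\<close>
  have y: "min (hamming x y) (2 * k - hamming x y) = Suc m"
    using Suc.prems hle assms(1-3) by (auto simp: signed_hamming_def split: if_splits)
  then have "y \<notin> set p" using p(4) by auto
  moreover have "p \<noteq> []" using p(1) by (auto simp: is_path_def is_walk_iff)
  ultimately have "is_path (SPC n) x y (p @ [y]) (s @ [e])"
    using p(1) e(1) Suc.prems(1) by (auto simp: is_path_def is_walk_snoc)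
  moreover have "prod_list (s @ [e]) = (if b then 1 else -1)" using p(3) e(2) by simp
  moreover have "\<forall>v \<in> set (p @ [y]). min (hamming x v) (2 * k - hamming x v) \<le> Suc m"
    using p(4) y by fastforce
  ultimately show ?case using p(2) by (metis length_append_singleton)
qed

text \<open>With \<open>h\<close> the Hamming distance, the shortest positive and negative paths
  have lengths \<open>h\<close> and \<open>2 * k - h\<close> whenever these are at most
  \<open>k\<close>. The smaller one decides, and the tie \<open>h = k\<close> counts as
  positive.\<close>

lemma alg_dist_SPC:
  assumes n: "n = 2 * k - 1" "0 < k" and len: "length x = n" "length y = n"
  shows "alg_dist (SPC n) x y =
    (if hamming x y \<le> k then int (hamming x y) else int (hamming x y) - 2 * int k)"
proof -
  let ?h = "hamming x y"
  define m where "m = min ?h (2 * k - ?h)"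
  have hle: "?h \<le> n" using hamming_le[of x y] len by simp
  have path: "\<exists>p s. is_path (SPC n) x y p s \<and> length s = signed_hamming b x y \<and>
      prod_list s = (if b then 1 else -1)" if "signed_hamming b x y \<le> k" for b
    using SPC_path_exists[OF n len refl that] by blast
  have low: "signed_hamming (prod_list s = 1) x y \<le> length s"
    if "is_path (SPC n) x y p s" for p s
    using SPC_walk_length[of n p s x] that by (auto simp: is_path_def)
  have m_eq: "m = signed_hamming (?h \<le> k) x y" "m \<le> k"
    using n len hle by (auto simp: m_def signed_hamming_def)
  have sd: "sdist (SPC n) x y = m"
    unfolding sdist_def
  proof (rule Least_equality)
    show "\<exists>p s. is_path (SPC n) x y p s \<and> length s = m"
      using path m_eq by metis
    fix l assume "\<exists>p s. is_path (SPC n) x y p s \<and> length s = l"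
    then show "m \<le> l"
      using low n len by (fastforce simp: m_def signed_hamming_def split: if_splits)
  qed
  have "(\<exists>p s. is_path (SPC n) x y p s \<and> length s = m \<and> prod_list s = 1) \<longleftrightarrow> ?h \<le> k"
  proof
    assume "\<exists>p s. is_path (SPC n) x y p s \<and> length s = m \<and> prod_list s = 1"
    then show "?h \<le> k"
      using low n len hle by (fastforce simp: m_def signed_hamming_def)
  next
    assume "?h \<le> k"
    then show "\<exists>p s. is_path (SPC n) x y p s \<and> length s = m \<and> prod_list s = 1"
      using path[of True] m_eq by (auto simp: signed_hamming_def)
  qed
  then show ?thesis
    unfolding alg_dist_def sd using hle n by (auto simp: m_def)
qed

section \<open>Wide graphs as even metrics\<close>

lemma is_walk_rev [simp]: "is_walk G (rev p) (rev s) \<longleftrightarrow> is_walk G p s"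
proof -
  have "is_walk G (rev p) (rev s)" if "is_walk G p s" for p s
  proof -
    have "({rev p ! i, rev p ! Suc i}, rev s ! i) \<in> sedges G" if "i < length s" for i
    proof -
      let ?j = "length s - Suc i"
      have "({p ! ?j, p ! Suc ?j}, s ! ?j) \<in> sedges G"
        using \<open>is_walk G p s\<close> that by (auto simp: is_walk_iff)
      moreover have "rev p ! i = p ! Suc ?j" "rev p ! Suc i = p ! ?j" "rev s ! i = s ! ?j"
        using \<open>is_walk G p s\<close> that by (auto simp: is_walk_iff rev_nth Suc_diff_Suc)
      ultimately show ?thesis by (simp add: insert_commute)
    qed
    with that show ?thesis by (simp add: is_walk_iff)
  qed
  from this[of p s] this[of "rev p" "rev s"] show ?thesis by auto
qed

text \<open>Already the pairs of ends are distinct, so the signs need no attention. Length 2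
  differs: there both edges have the same two ends.\<close>

lemma distinct_walk_edges:
  assumes "length p = Suc (length s)" "3 \<le> length s" "hd p = last p" "distinct (tl p)"
  shows "distinct (walk_edges p s)"
proof -
  let ?L = "length s"
  \<comment> \<open>Positions start at 1 because the first vertex recurs at the end; position 0 is
    handled below as position \<open>?L\<close>.\<close>
  have inj: "i = j" if "p ! i = p ! j" "1 \<le> i" "1 \<le> j" "i \<le> ?L" "j \<le> ?L" for i j
  proof -
    have "tl p ! (i - 1) = tl p ! (j - 1)" "i - 1 < length (tl p)" "j - 1 < length (tl p)"
      using that assms(1) by (auto simp: nth_tl)
    then have "i - 1 = j - 1" using assms(4) nth_eq_iff_index_eq by blast
    then show ?thesis using that by simp
  qed
  have "p \<noteq> []" using assms(1) by auto
  then have closed: "p ! 0 = p ! ?L" using assms(1,3) by (simp add: hd_conv_nth last_conv_nth)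
  have ne: "{p ! i, p ! Suc i} \<noteq> {p ! j, p ! Suc j}" if "i < j" "j < ?L" for i j
  proof
    assume "{p ! i, p ! Suc i} = {p ! j, p ! Suc j}"
    then consider "p ! i = p ! j" | "p ! i = p ! Suc j" "p ! Suc i = p ! j"
      by (auto simp: doubleton_eq_iff)
    then show False
    proof cases
      case 1
      then show False
        using inj[of i j] inj[of ?L j] closed that by (cases "i = 0") auto
    next
      case 2
      then have "j = Suc i" using inj[of "Suc i" j] that by simp
      \<comment> \<open>Now \<open>p ! i\<close> equals \<open>p ! Suc (Suc i)\<close>. For
        \<open>i = 0\<close> this would make the closed walk end after two edges.\<close>
      with 2 show False
        using inj[of i "Suc j"] inj[of ?L "Suc j"] closed that assms(2) by (cases "i = 0") auto
    qed
  qed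
  have "i = j" if "{p ! i, p ! Suc i} = {p ! j, p ! Suc j}" "i < ?L" "j < ?L" for i j
    using ne[of i j] ne[of j i] that by (metis linorder_neqE_nat)
  then show ?thesis
    by (auto simp: walk_edges_def distinct_map inj_on_def)
qed

section \<open>The two paths substituted for an edge\<close>

definition path_walk :: "nat \<Rightarrow> 'a \<Rightarrow> 'a \<Rightarrow> int \<Rightarrow> bool \<Rightarrow> 'a gvert list" where
  "path_walk k x y a b = map (path_vertex k x y a b) [0..<Suc (path_length k a b)]"

definition path_signs :: "nat \<Rightarrow> int \<Rightarrow> bool \<Rightarrow> int list" where
  "path_signs k a b = map (\<lambda>i. if i = 0 then path_sign a b else 1) [0..<path_length k a b]"

lemma length_path_walk [simp]: "length (path_walk k x y a b) = Suc (path_length k a b)"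
  and length_path_signs [simp]: "length (path_signs k a b) = path_length k a b"
  by (simp_all add: path_walk_def path_signs_def)

lemma is_walk_path_walk:
  assumes "x < y" "{x, y} \<in> wedges H"
  shows "is_walk (double_subst k H) (path_walk k x y (wt H x y) b) (path_signs k (wt H x y) b)"
proof -
  let ?f = "path_vertex k x y (wt H x y) b"
  have nth: "path_walk k x y (wt H x y) b ! i = ?f i" if "i \<le> path_length k (wt H x y) b" for i
    using that by (simp add: path_walk_def del: upt_Suc)
  have vert: "?f i \<in> sverts (double_subst k H)" if "i \<le> path_length k (wt H x y) b" for i
    using assms that unfolding double_subst_def sgraph.simps by blast
  have edge: "({?f i, ?f (Suc i)}, if i = 0 then path_sign (wt H x y) b else 1)
      \<in> sedges (double_subst k H)" if "i < path_length k (wt H x y) b" for i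
    using assms that unfolding double_subst_def sgraph.simps by blast
  show ?thesis
    unfolding is_walk_iff
  proof (intro conjI allI impI)
    show "set (path_walk k x y (wt H x y) b) \<subseteq> sverts (double_subst k H)"
      using vert by (auto simp: path_walk_def simp del: upt_Suc)
  qed (use edge in \<open>auto simp: nth path_signs_def\<close>)
qed

lemma path_walk_Cons:
  "path_walk k x y a b = Orig x # map (path_vertex k x y a b) [1..<Suc (path_length k a b)]"
  by (simp add: path_walk_def path_vertex_def upt_conv_Cons del: upt_Suc)

lemma path_walk_snoc:
  assumes "0 < path_length k a b"
  shows "path_walk k x y a b = map (path_vertex k x y a b) [0..<path_length k a b] @ [Orig y]"
  using assms by (simp add: path_walk_def path_vertex_def)

lemma path_walk_neq_Nil [simp]: "path_walk k x y a b \<noteq> []"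
  by (simp add: path_walk_Cons)

lemma hd_path_walk [simp]: "hd (path_walk k x y a b) = Orig x"
  by (simp add: path_walk_Cons)

lemma last_path_walk [simp]:
  "0 < path_length k a b \<Longrightarrow> last (path_walk k x y a b) = Orig y"
  by (simp add: path_walk_snoc)

text \<open>Paths glued end to end lose a common end. Inner vertices carry the names of both ends
  and the index of their path, so disjointness of the remaining vertices can be read off.\<close>

lemma set_tl_path_walk:
  assumes "0 < path_length k a b"
  shows "set (tl (path_walk k x y a b)) =
    insert (Orig y) (Inner x y b ` {1..<path_length k a b})"
proof -
  have "{1..<Suc (path_length k a b)} = insert (path_length k a b) {1..<path_length k a b}"
    using assms by auto
  moreover have "path_vertex k x y a b ` {1..<path_length k a b} =
      Inner x y b ` {1..<path_length k a b}"
    by (rule image_cong) (auto simp: path_vertex_def)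
  moreover have "path_vertex k x y a b (path_length k a b) = Orig y"
    using assms by (simp add: path_vertex_def)
  ultimately show ?thesis by (simp add: path_walk_Cons del: upt_Suc)
qed

lemma set_butlast_path_walk:
  assumes "0 < path_length k a b"
  shows "set (butlast (path_walk k x y a b)) =
    insert (Orig x) (Inner x y b ` {1..<path_length k a b})"
proof -
  have "{0..<path_length k a b} = insert 0 {1..<path_length k a b}"
    using assms by auto
  moreover have "path_vertex k x y a b ` {1..<path_length k a b} =
      Inner x y b ` {1..<path_length k a b}"
    by (rule image_cong) (auto simp: path_vertex_def)
  moreover have "path_vertex k x y a b 0 = Orig x"
    by (simp add: path_vertex_def)
  ultimately show ?thesis using assms by (simp add: path_walk_snoc)
qed

lemma distinct_path_walk:
  assumes "x \<noteq> y"
  shows "distinct (path_walk k x y a b)"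
  using assms by (auto simp: path_walk_def distinct_map inj_on_def path_vertex_def simp del: upt_Suc)

lemma prod_list_path_signs:
  assumes "0 < path_length k a b"
  shows "prod_list (path_signs k a b) = path_sign a b"
proof -
  have "path_signs k a b = path_sign a b # map (\<lambda>i. 1) [1..<path_length k a b]"
    using assms by (simp add: path_signs_def upt_conv_Cons)
  then show ?thesis by (simp add: map_replicate_const)
qed

section \<open>Inequalities from negative cycles\<close>

lemma negative_cycle_length:
  assumes "unbalanced_girth G = enat m" "is_cycle G p s" "prod_list s = -1"
  shows "m \<le> length s"
proof -
  have "unbalanced_girth G \<le> enat (length s)"
    unfolding unbalanced_girth_def using assms(2,3) by (intro Inf_lower) blast
  then show ?thesis using assms(1) by simp
qed

text \<open>Choosing one of the two paths for each side of the triangle gives a cycle through its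
  three corners. If its sign is negative, the unbalanced girth bounds its length from below.\<close>

lemma wide_triangle:
  fixes H :: "'a::linorder wgraph"
  assumes "wide k H" "x < y" "y < z"
    and edges: "{x, y} \<in> wedges H" "{y, z} \<in> wedges H" "{x, z} \<in> wedges H"
    and neg: "path_sign (wt H x y) b * path_sign (wt H y z) c * path_sign (wt H x z) d = -1"
  shows "2 * k \<le> path_length k (wt H x y) b + path_length k (wt H y z) c +
    path_length k (wt H x z) d"
proof -
  \<comment> \<open>Both paths of an edge are nonempty since the absolute weight lies between 1 and
    \<open>k\<close>. Hence the cycle below has at least three edges.\<close>
  have pos: "0 < path_length k (wt H u v) e" if "{u, v} \<in> wedges H" for u v e
  proof -
    have "1 \<le> \<bar>wt H u v\<bar>" "\<bar>wt H u v\<bar> \<le> int k" using assms(1) that by (auto simp: wide_def)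
    then show ?thesis by (auto simp: path_length_def)
  qed
  note pos = pos[OF edges(1), of b] pos[OF edges(2), of c] pos[OF edges(3), of d]
  let ?P = "path_walk k x y (wt H x y) b" and ?Q = "path_walk k y z (wt H y z) c"
    and ?R = "path_walk k x z (wt H x z) d"
  \<comment> \<open>The third path is traversed backwards, from \<open>z\<close> to
    \<open>x\<close>; \<open>tl\<close> drops the corners that would be listed twice.\<close>
  let ?p = "?P @ tl ?Q @ tl (rev ?R)"
  let ?s = "path_signs k (wt H x y) b @ path_signs k (wt H y z) c @
    rev (path_signs k (wt H x z) d)"
  have Q: "Orig y # tl ?Q @ tl (rev ?R) = ?Q @ tl (rev ?R)"
    by (simp add: path_walk_Cons)
  have R: "Orig z # tl (rev ?R) = rev ?R"
    using pos by (simp add: path_walk_snoc)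
  have "x < z" using assms(2,3) by simp
  then have "is_walk (double_subst k H) (?Q @ tl (rev ?R))
      (path_signs k (wt H y z) c @ rev (path_signs k (wt H x z) d))"
    using assms pos by (subst is_walk_append) (simp_all add: R is_walk_path_walk)
  then have "is_walk (double_subst k H) (Orig y # tl ?Q @ tl (rev ?R))
      (path_signs k (wt H y z) c @ rev (path_signs k (wt H x z) d))"
    by (simp only: Q)
  then have walk: "is_walk (double_subst k H) ?p ?s"
    using assms pos by (subst is_walk_append) (simp_all add: is_walk_path_walk)
  have tlR: "tl (rev ?R) = rev (butlast ?R)" by (metis butlast_rev rev_rev_ident)
  have dist: "distinct (tl ?p)"
    using distinct_path_walk[of x y k "wt H x y" b] distinct_path_walk[of y z k "wt H y z" c]
      distinct_path_walk[of x z k "wt H x z" d] pos assms(2,3)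
    by (auto simp: tl_append2 tlR set_tl_path_walk set_butlast_path_walk distinct_tl
        distinct_butlast)
  have "map (path_vertex k x z (wt H x z) d) [0..<path_length k (wt H x z) d] =
      Orig x # map (path_vertex k x z (wt H x z) d) [1..<path_length k (wt H x z) d]"
    using pos by (simp add: upt_conv_Cons path_vertex_def)
  then have "tl (rev ?R) = rev (map (path_vertex k x z (wt H x z) d)
      [1..<path_length k (wt H x z) d]) @ [Orig x]"
    using pos by (simp add: path_walk_snoc)
  then have "hd ?p = last ?p" by simp
  moreover have "3 \<le> length ?s" using pos by simp
  moreover have "length ?p = Suc (length ?s)" using walk by (simp only: is_walk_iff)
  ultimately have "is_cycle (double_subst k H) ?p ?s"
    unfolding is_cycle_def using walk dist distinct_walk_edges[of ?p ?s] by fastforce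
  moreover have "prod_list ?s = -1"
    using neg pos by (simp add: prod_list_path_signs prod_list.rev mult.assoc)
  ultimately show ?thesis
    using negative_cycle_length[of "double_subst k H" "2 * k" ?p ?s] assms(1)
    by (simp add: wide_def)
qed

text \<open>The length of the positive one of the two paths that replace an edge of weight \<open>a\<close>. Unlike
  the weight itself it does not distinguish \<open>k\<close> from \<open>-k\<close>.\<close>

definition positive_length :: "nat \<Rightarrow> int \<Rightarrow> nat" where
  "positive_length k a = path_length k a (0 < a)"

text \<open>Positive weights have positive lengths from 1 to \<open>k\<close>, negative ones from
  \<open>k\<close> to \<open>2 * k - 1\<close>. Each range is met injectively, and they overlap only
  at \<open>k\<close>, for the weights \<open>k\<close> and \<open>-k\<close>.\<close>

lemma same_weight_iff:
  assumes "a \<noteq> 0" "b \<noteq> 0" "\<bar>a\<bar> \<le> int k" "\<bar>b\<bar> \<le> int k"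
  shows "same_weight k a b \<longleftrightarrow> positive_length k a = positive_length k b"
  using assms by (auto simp: same_weight_def positive_length_def path_length_def)

text \<open>A choice of paths is negative when an odd number of them is. A negative path on one side
  only gives a triangle inequality, negative paths on all three sides give the perimeter bound.
  Evenness comes from bipartiteness, as the positive length has the parity of the weight.\<close>

lemma wide_bipartite_even_triangle:
  fixes H :: "'a::linorder wgraph"
  assumes H: "signed_weighted_graph H" "complete_graph H" "wide k H" "bipartite H"
    and xyz: "{x, y, z} \<subseteq> wverts H" "x \<noteq> y" "x \<noteq> z" "y \<noteq> z"
  shows "even_triangle (2 * k) (positive_length k (wt H x y)) (positive_length k (wt H x z))
    (positive_length k (wt H y z))"
proof -
  have edge: "{u, v} \<in> wedges H" if "u \<in> wverts H" "v \<in> wverts H" "u \<noteq> v" for u v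
    using H(2) that by (simp add: complete_graph_def pairs_def)
  have sym: "wt H u v = wt H v u" if "u \<in> wverts H" "v \<in> wverts H" for u v
    using H(1) edge[OF that] by (cases "u = v") (auto simp: signed_weighted_graph_def)
  have bound: "wt H u v \<noteq> 0" "\<bar>wt H u v\<bar> \<le> int k"
    if "u \<in> wverts H" "v \<in> wverts H" "u \<noteq> v" for u v
    using H(3) edge[OF that] by (fastforce simp: wide_def)+
  obtain A where A: "\<And>u v. {u, v} \<in> wedges H \<Longrightarrow> odd (wt H u v) \<longleftrightarrow> (u \<in> A) \<noteq> (v \<in> A)"
    using H(4) unfolding bipartite_def by blast
  have parity: "even (positive_length k (wt H u v)) \<longleftrightarrow> (u \<in> A) = (v \<in> A)"
    if "u \<in> wverts H" "v \<in> wverts H" "u \<noteq> v" for u v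
  proof -
    have "even (positive_length k (wt H u v)) \<longleftrightarrow> even (wt H u v)"
      using bound[OF that] by (auto simp: positive_length_def path_length_def even_nat_iff)
    then show ?thesis using A[OF edge[OF that]] by blast
  qed
  \<comment> \<open>The paths of \<open>double_subst\<close> run from the smaller end to the larger,
    so the corners are first taken in increasing order.\<close>
  have ordered: "even_triangle (2 * k) (positive_length k (wt H u v))
      (positive_length k (wt H u w)) (positive_length k (wt H v w))"
    if V: "u \<in> wverts H" "v \<in> wverts H" "w \<in> wverts H" and lt: "u < v" "v < w" for u v w
  proof -
    let ?a = "wt H u v" and ?b = "wt H v w" and ?c = "wt H u w"
    have nz: "?a \<noteq> 0" "?b \<noteq> 0" "?c \<noteq> 0" "\<bar>?a\<bar> \<le> int k" "\<bar>?b\<bar> \<le> int k" "\<bar>?c\<bar> \<le> int k"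
      using bound V lt by auto
    have e: "{u, v} \<in> wedges H" "{v, w} \<in> wedges H" "{u, w} \<in> wedges H"
      using edge V lt by auto
    \<comment> \<open>The index \<open>0 < a\<close> selects the positive one of the two paths,
      whatever the sign of \<open>a\<close>.\<close>
    have sign: "path_sign a (0 < a) = 1" "path_sign a (\<not> 0 < a) = -1" if "a \<noteq> 0" for a
      using that by (auto simp: path_sign_def)
    have len: "path_length k a (0 < a) = positive_length k a"
      "int (path_length k a (\<not> 0 < a)) = 2 * int k - int (positive_length k a)"
      if "\<bar>a\<bar> \<le> int k" for a
      using that by (auto simp: positive_length_def path_length_def)
    note wide = wide_triangle[OF H(3) lt e]
    note tri = wide[of "\<not> 0 < ?a" "0 < ?b" "0 < ?c"] wide[of "0 < ?a" "\<not> 0 < ?b" "0 < ?c"]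
      wide[of "0 < ?a" "0 < ?b" "\<not> 0 < ?c"] wide[of "\<not> 0 < ?a" "\<not> 0 < ?b" "\<not> 0 < ?c"]
    have le: "int (positive_length k ?a) \<le> int (positive_length k ?b) + int (positive_length k ?c)"
      "int (positive_length k ?b) \<le> int (positive_length k ?a) + int (positive_length k ?c)"
      "int (positive_length k ?c) \<le> int (positive_length k ?a) + int (positive_length k ?b)"
      "int (positive_length k ?a) + int (positive_length k ?b) + int (positive_length k ?c)
        \<le> 4 * int k"
      using tri[unfolded sign[OF nz(1)] sign[OF nz(2)] sign[OF nz(3)]
          zle_int[symmetric] of_nat_add of_nat_mult len[OF nz(4)] len[OF nz(5)] len[OF nz(6)]]
      by simp_all
    have "even (positive_length k ?a + positive_length k ?c + positive_length k ?b)"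
      using parity V lt by auto
    then show ?thesis using le unfolding even_triangle_def by linarith
  qed
  consider "x < y" "y < z" | "x < z" "z < y" | "y < x" "x < z" | "y < z" "z < x"
    | "z < x" "x < y" | "z < y" "y < x"
    using xyz by (metis linorder_neqE)
  then show ?thesis
    using ordered[of x y z] ordered[of x z y] ordered[of y x z] ordered[of y z x]
      ordered[of z x y] ordered[of z y x] xyz(1) sym[of x y] sym[of x z] sym[of y z]
    by cases (auto intro: even_triangle_perms)
qed

section \<open>Lifting to the cube of dimension \<open>n + 1\<close>\<close>

text \<open>The signed projective cube is covered twice by the cube of dimension \<open>n + 1\<close>, whose vertices
  are subsets of \<open>{..n}\<close>; the two lifts of a vertex are complementary, and switching at a vertex
  exchanges them.\<close>

definition lift :: "nat \<Rightarrow> bool \<Rightarrow> bit list \<Rightarrow> nat set" where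
  "lift n b x = {i. i < n \<and> (x ! i = 1) \<noteq> b} \<union> (if b then {n} else {})"

lemma mem_lift: "i \<in> lift n b x \<longleftrightarrow> (if i < n then (x ! i = 1) \<noteq> b else i = n \<and> b)"
  by (auto simp: lift_def)

text \<open>Equal flags cancel. Unequal flags complement the set of differing places inside all
  \<open>n + 1\<close> places, which yields the negative length.\<close>

lemma card_lift_diff:
  assumes "length x = n" "length y = n"
  shows "card {i \<in> {..<Suc n}. (i \<in> lift n b x) \<noteq> (i \<in> lift n c y)} = signed_hamming (b = c) x y"
proof -
  let ?D = "{i. i < n \<and> x ! i \<noteq> y ! i}"
  have mem: "(i \<in> lift n b x) \<noteq> (i \<in> lift n c y) \<longleftrightarrow> (i \<in> ?D) \<noteq> (b \<noteq> c)" if "i < Suc n" for i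
  proof (cases "i < n")
    case True
    then show ?thesis by (cases "x ! i"; cases "y ! i") (simp_all add: mem_lift)
  next
    case False
    then show ?thesis using that by (simp add: mem_lift)
  qed
  have "{i \<in> {..<Suc n}. (i \<in> lift n b x) \<noteq> (i \<in> lift n c y)} =
      (if b = c then ?D else {..<Suc n} - ?D)" (is "?L = ?R")
  proof (rule set_eqI)
    fix i
    show "i \<in> ?L \<longleftrightarrow> i \<in> ?R"
      using mem[of i] by (cases "i < Suc n") auto
  qed
  moreover have "card ({..<Suc n} - ?D) = Suc n - card ?D"
    by (subst card_Diff_subset) auto
  ultimately show ?thesis
    using assms by (simp add: signed_hamming_def hamming_def)
qed

lemma lift_surj:
  assumes "Y \<subseteq> {..<Suc n}"
  obtains b x where "length x = n" "Y = lift n b x"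
proof (rule that)
  \<comment> \<open>Membership of \<open>n\<close> tells which of the two lifts \<open>Y\<close> is;
    if \<open>n\<close> belongs to \<open>Y\<close>, the other places are complemented back.\<close>
  let ?x = "map (\<lambda>i. if (i \<in> Y) \<noteq> (n \<in> Y) then 1 else 0 :: bit) [0..<n]"
  show "length ?x = n" by simp
  show "Y = lift n (n \<in> Y) ?x"
  proof (rule set_eqI)
    fix i
    consider "i < n" | "i = n" | "n < i" by linarith
    then show "i \<in> Y \<longleftrightarrow> i \<in> lift n (n \<in> Y) ?x"
      using assms by cases (simp_all add: mem_lift, auto)
  qed
qed

text \<open>In both cases of \<open>alg_dist_SPC\<close> the positive length is the Hamming
  distance. Negating the weight exchanges the two paths and gives \<open>2 * k\<close> minus that
  distance.\<close>

lemma signed_hamming_eq_positive_length: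
  assumes "n = 2 * k - 1" "0 < k" "length x = n" "length y = n" "x \<noteq> y"
  shows "signed_hamming (b = c) x y =
    positive_length k (if b \<noteq> c then - alg_dist (SPC n) x y else alg_dist (SPC n) x y)"
proof -
  have "hamming x y \<noteq> 0" "hamming x y \<le> n"
    using assms hamming_eq_0_iff[of x n y] hamming_le[of x y] by auto
  then show ?thesis
    using assms by (auto simp: alg_dist_SPC signed_hamming_def positive_length_def path_length_def)
qed

lemma alg_dist_SPC_bounds:
  assumes "n = 2 * k - 1" "0 < k" "length x = n" "length y = n" "x \<noteq> y"
  shows "alg_dist (SPC n) x y \<noteq> 0" "\<bar>alg_dist (SPC n) x y\<bar> \<le> int k"
  using assms hamming_eq_0_iff[of x n y] hamming_le[of x y] by (auto simp: alg_dist_SPC)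

lemma alg_dist_SPC_commute:
  assumes "n = 2 * k - 1" "0 < k" "length x = n" "length y = n"
  shows "alg_dist (SPC n) x y = alg_dist (SPC n) y x"
  using assms hamming_commute[of x y] by (simp add: alg_dist_SPC)

section \<open>Switching, cliques and the extension of an isomorphism\<close>

lemma induced_sel [simp]:
  "wverts (induced U H) = U" "wedges (induced U H) = {e \<in> wedges H. e \<subseteq> U}"
  "wt (induced U H) = wt H"
  by (simp_all add: induced_def)

lemma wt_switch:
  "wt (switch S H) x y = (if (x \<in> S) \<noteq> (y \<in> S) then - wt H x y else wt H x y)"
  by (simp add: switch_def)

lemma wt_switch_induced [simp]: "wt (switch S (induced U H)) = wt (switch S H)"
  by (simp add: wt_switch fun_eq_iff)

lemma image_pairs:
  assumes "bij_betw f U V"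
  shows "(\<lambda>e. f ` e) ` pairs U = pairs V"
proof -
  have inj: "inj_on f U" and V: "f ` U = V" using assms by (auto simp: bij_betw_def)
  have "f ` e \<in> pairs V" if "e \<in> pairs U" for e
    using that inj V by (auto simp: pairs_def card_image inj_on_subset)
  moreover have "\<exists>e \<in> pairs U. f ` e = e'" if "e' \<in> pairs V" for e'
  proof -
    obtain e where "e \<subseteq> U" "e' = f ` e"
      using \<open>e' \<in> pairs V\<close> V by (auto simp: pairs_def subset_image_iff)
    then show ?thesis
      using that inj by (auto simp: pairs_def card_image inj_on_subset intro!: bexI[of _ e])
  qed
  ultimately show ?thesis by (auto simp: image_iff) metis
qed

theorem theorem5:
  fixes k :: nat
  assumes "0 < k"
  shows "closed3 (K_SPC (2 * k - 1)) k (cliques 4 (K_SPC (2 * k - 1)))"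
proof -
  define n where "n = 2 * k - 1"
  have Suc_n: "Suc n = 2 * k" using assms by (simp add: n_def)
  note nk = n_def assms
  let ?G = "K_SPC n"
  have "\<exists>K' \<in> cliques 4 ?G. wverts K - {v} \<subseteq> wverts K' \<and>
      (\<exists>S' \<xi>'. weighted_iso k K' X S' \<xi>' \<and> S' \<inter> (wverts K - {v}) = S \<and>
        (\<forall>u \<in> wverts K - {v}. \<xi>' u = \<xi> u))"
    if K: "K \<in> cliques 4 ?G" and v: "v \<in> wverts K" and X: "X \<in> wide_complete 4 k"
      and x: "x \<in> wverts X" and iso: "weighted_iso k (delete_vertex K v) (delete_vertex X x) S \<xi>"
    for K v X x S \<xi>
  proof -
    obtain W where W: "K = induced W ?G" "W \<subseteq> wverts ?G" "finite W" "card W = 4"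
      using K by (auto simp: cliques_def)
    define U where "U = wverts K - {v}"
    have vW: "v \<in> W" and U_W: "U = W - {v}" using v W by (simp_all add: U_def)
    have finU: "finite U" and cardU: "card U = 3" using W vW by (simp_all add: U_W)
    have lenU: "length u = n" if "u \<in> U" for u using that W by (auto simp: U_W K_SPC_def)
    have UX: "wverts (delete_vertex K v) = U" "wedges (delete_vertex K v) = pairs U"
      "wt (switch S (delete_vertex K v)) = wt (switch S ?G)"
      using W by (auto simp: delete_vertex_def U_W K_SPC_def pairs_def)
    have X': "signed_weighted_graph X" "complete_graph X" "wide k X" "bipartite X"
      "card (wverts X) = 4"
      using X by (auto simp: wide_complete_def)
    have S: "S \<subseteq> U" and \<xi>: "bij_betw \<xi> U (wverts X - {x})"
      and wtU: "\<And>u w. {u, w} \<in> pairs U \<Longrightarrow>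
        same_weight k (wt (switch S ?G) u w) (wt X (\<xi> u) (\<xi> w))"
      using iso unfolding weighted_iso_def UX by (auto simp: delete_vertex_def)
    have wtX: "wt X p q \<noteq> 0" "\<bar>wt X p q\<bar> \<le> int k" "wt X p q = wt X q p"
      if "p \<in> wverts X" "q \<in> wverts X" "p \<noteq> q" for p q
    proof -
      have "{p, q} \<in> wedges X" using that X'(2) by (auto simp: complete_graph_def pairs_def)
      then show "wt X p q \<noteq> 0" "\<bar>wt X p q\<bar> \<le> int k" "wt X p q = wt X q p"
        using X'(1,3) by (fastforce simp: wide_def signed_weighted_graph_def)+
    qed
    have \<xi>X: "\<xi> u \<in> wverts X" "\<xi> u \<noteq> x" "x \<noteq> \<xi> u" if "u \<in> U" for u
      using \<xi> that by (auto simp: bij_betw_def)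
    have \<xi>_neq: "\<xi> u \<noteq> \<xi> w" if "u \<in> U" "w \<in> U" "u \<noteq> w" for u w
      using \<xi> that by (auto simp: bij_betw_def inj_on_def)
    \<comment> \<open>Matching of weights becomes an equality of distances in the double cover. The
      switching set \<open>T\<close> is arbitrary, to serve both for \<open>S\<close> and for its
      extension \<open>S'\<close>.\<close>
    have same_iff: "same_weight k (wt (switch T ?G) u w) (wt X p q) \<longleftrightarrow>
        signed_hamming ((u \<in> T) = (w \<in> T)) u w = positive_length k (wt X p q)"
      if "length u = n" "length w = n" "u \<noteq> w" "p \<in> wverts X" "q \<in> wverts X" "p \<noteq> q"
      for T u w p q
      using that wtX[of p q] alg_dist_SPC_bounds[OF nk, of u w]
        signed_hamming_eq_positive_length[OF nk, of u w "u \<in> T" "w \<in> T"]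
      by (auto simp: wt_switch K_SPC_def same_weight_iff)
    \<comment> \<open>Each vertex is lifted according to its membership in \<open>S\<close>, so the
      lifts have the distances prescribed by \<open>X\<close>.\<close>
    have distU: "card {i \<in> {..<Suc n}. (i \<in> lift n (u \<in> S) u) \<noteq> (i \<in> lift n (w \<in> S) w)} =
        positive_length k (wt X (\<xi> u) (\<xi> w))" if "u \<in> U" "w \<in> U" "u \<noteq> w" for u w
    proof -
      have "same_weight k (wt (switch S ?G) u w) (wt X (\<xi> u) (\<xi> w))"
        using that by (intro wtU) (auto simp: pairs_def)
      then show ?thesis
        using that lenU \<xi>X \<xi>_neq by (subst card_lift_diff) (simp_all add: same_iff)
    qed
    obtain u1 u2 u3 where u: "U = {u1, u2, u3}" "u1 \<noteq> u2" "u1 \<noteq> u3" "u2 \<noteq> u3"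
      using cardU by (auto simp: card_3_iff)
    have tri: "even_triangle (card {..<Suc n}) (positive_length k (wt X x (\<xi> u)))
        (positive_length k (wt X x (\<xi> w)))
        (card {i \<in> {..<Suc n}. (i \<in> lift n (u \<in> S) u) \<noteq> (i \<in> lift n (w \<in> S) w)})"
      if "u \<in> U" "w \<in> U" "u \<noteq> w" for u w
      using wide_bipartite_even_triangle[OF X'(1-4), of x "\<xi> u" "\<xi> w"] that x \<xi>X \<xi>_neq
      by (subst distU) (simp_all add: Suc_n)
    have uU: "u1 \<in> U" "u2 \<in> U" "u3 \<in> U" using u by simp_all
    obtain Y where Y_sub: "Y \<subseteq> {..<Suc n}" and Y:
      "card {i \<in> {..<Suc n}. (i \<in> Y) \<noteq> (i \<in> lift n (u1 \<in> S) u1)} =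
        positive_length k (wt X x (\<xi> u1))"
      "card {i \<in> {..<Suc n}. (i \<in> Y) \<noteq> (i \<in> lift n (u2 \<in> S) u2)} =
        positive_length k (wt X x (\<xi> u2))"
      "card {i \<in> {..<Suc n}. (i \<in> Y) \<noteq> (i \<in> lift n (u3 \<in> S) u3)} =
        positive_length k (wt X x (\<xi> u3))"
      by (rule ex_fourth_set[OF finite_lessThan tri[OF uU(1,2) u(2)] tri[OF uU(1,3) u(3)]
            tri[OF uU(2,3) u(4)]])
    \<comment> \<open>The lift \<open>Y\<close> determines both the new vertex \<open>y\<close> and,
      through \<open>b\<close>, whether to switch at it.\<close>
    obtain b y where y: "length y = n" "Y = lift n b y" by (rule lift_surj[OF Y_sub])
    have dist_y: "signed_hamming (b = (u \<in> S)) y u = positive_length k (wt X x (\<xi> u))"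
      if "u \<in> U" for u
      using that Y[unfolded y(2) card_lift_diff[OF y(1) lenU[OF uU(1)]]
          card_lift_diff[OF y(1) lenU[OF uU(2)]] card_lift_diff[OF y(1) lenU[OF uU(3)]]]
      unfolding u(1) by auto
    \<comment> \<open>A vertex has signed distance 0 or \<open>2 * k\<close> from itself, whereas
      the positive length of an edge of \<open>X\<close> lies strictly between these values.\<close>
    have "y \<notin> U"
    proof
      assume "y \<in> U"
      then have "signed_hamming (b = (y \<in> S)) y y = positive_length k (wt X x (\<xi> y))"
        by (rule dist_y)
      then show False
        using wtX[of x "\<xi> y"] \<xi>X[OF \<open>y \<in> U\<close>] x y(1) Suc_n
        by (auto simp: signed_hamming_def hamming_def positive_length_def path_length_def
            split: if_splits)
    qed
    define U' where "U' = insert y U"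
    define K' where "K' = induced U' ?G"
    define S' where "S' = (if b then insert y S else S)"
    define \<xi>' where "\<xi>' = \<xi>(y := x)"
    have lenU': "length u = n" if "u \<in> U'" for u using that lenU y by (auto simp: U'_def)
    have K': "wverts K' = U'" "wedges K' = pairs U'" "wt (switch S' K') = wt (switch S' ?G)"
      using lenU' by (auto simp: K'_def K_SPC_def pairs_def)
    have "U' \<subseteq> wverts ?G" "finite U'" "card U' = 4" "pairs U' \<subseteq> wedges ?G"
      using lenU' finU cardU \<open>y \<notin> U\<close> by (auto simp: U'_def K_SPC_def pairs_def)
    then have clique: "K' \<in> cliques 4 ?G" by (auto simp: cliques_def K'_def)
    have S'_U: "u \<in> S' \<longleftrightarrow> u \<in> S" if "u \<in> U" for u
      using that \<open>y \<notin> U\<close> by (auto simp: S'_def)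
    have S'_y: "y \<in> S' \<longleftrightarrow> b" using S \<open>y \<notin> U\<close> by (auto simp: S'_def)
    have \<xi>'_U: "\<xi>' u = \<xi> u" if "u \<in> U" for u using that \<open>y \<notin> U\<close> by (auto simp: \<xi>'_def)
    have bij: "bij_betw \<xi>' U' (wverts X)"
    proof -
      have "bij_betw \<xi>' U (wverts X - {x})"
        using \<xi> \<xi>'_U by (simp cong: bij_betw_cong)
      then have "bij_betw \<xi>' (U \<union> {y}) (wverts X - {x} \<union> {x})"
        by (rule bij_betw_combine) (simp_all add: \<xi>'_def bij_betw_def)
      then show ?thesis using x by (simp add: U'_def insert_absorb)
    qed
    have wt': "same_weight k (wt (switch S' K') u w) (wt X (\<xi>' u) (\<xi>' w))"
      if "{u, w} \<in> pairs U'" for u w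
    proof -
      have mem: "u \<in> U'" "w \<in> U'" "u \<noteq> w" using that by (auto simp: pairs_def)
      have yU: "same_weight k (wt (switch S' ?G) y u) (wt X x (\<xi> u))" if "u \<in> U" for u
        using that dist_y[OF that] y lenU x \<xi>X \<open>y \<notin> U\<close>
        by (subst same_iff) (auto simp: S'_U S'_y)
      have sym: "wt (switch S' ?G) u w = wt (switch S' ?G) w u"
        using alg_dist_SPC_commute[OF nk] lenU' mem by (auto simp: wt_switch K_SPC_def)
      consider "u \<in> U" "w \<in> U" | "u = y" "w \<in> U" | "u \<in> U" "w = y"
        using mem by (auto simp: U'_def)
      then show ?thesis
      proof cases
        case 1
        then have "same_weight k (wt (switch S ?G) u w) (wt X (\<xi> u) (\<xi> w))"
          using mem by (intro wtU) (auto simp: pairs_def)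
        then show ?thesis using 1 unfolding K' by (simp add: wt_switch S'_U \<xi>'_U)
      next
        case 2
        then show ?thesis using yU[of w] unfolding K' by (simp add: \<xi>'_U) (simp add: \<xi>'_def)
      next
        case 3
        then show ?thesis
          using yU[of u] sym wtX(3)[of x "\<xi> u"] x \<xi>X unfolding K'
          by (simp add: \<xi>'_U) (simp add: \<xi>'_def)
      qed
    qed
    have "weighted_iso k K' X S' \<xi>'"
      unfolding weighted_iso_def K'(1,2)
    proof (intro conjI allI impI)
      show "S' \<subseteq> U'" using S by (auto simp: S'_def U'_def)
      show "(`) \<xi>' ` pairs U' = wedges X"
        using image_pairs[OF bij] X'(2) by (simp add: complete_graph_def)
    qed (use bij wt' in auto)
    moreover have "S' \<inter> U = S" using S S'_U by auto
    moreover have "U \<subseteq> wverts K'" by (auto simp: K' U'_def)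
    ultimately show ?thesis
      using clique \<xi>'_U unfolding U_def[symmetric] by blast
  qed
  then show ?thesis
    unfolding closed3_def n_def[symmetric] by blast
qed

end
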